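(* Let $G$ be an infinite finitely generated group and let $\sigma(G)$ be the full shift of $G$ on $\mathcal{A}^G$, where $\mathcal{A}$ is a finite alphabet. Let $\tau(G)$ denote the trivial action of $G$ on a single point. Then, as formal power series, \[ \zeta_{\sigma(G)}(z)=\zeta_{\tau(G)}(Az)=\prod_{n\geqslant 1}(1-A^nz^n)^{-b_G(n)}, \] where $A=|\mathcal{A}|$ and the exponents $b_G(n)\in\mathbb{Q}$, $n\geqslant 1$, are the coefficients of the Dirichlet series $\Delta_G(z)=\sum_{n\geqslant 1}b_G(n)n^{-z}$. Hence, the formal power series for $\zeta_{\sigma(G)}(z)$ has integer coefficients provided that the Dirichlet series $\Delta_G$ has integer coefficients.
   Context: For a finitely generated group $G$, $\mathcal{L}_G$ denotes the set of finite index subgroups of $G$, $[L]=[G:L]$ for $L\in\mathcal{L}_G$, and $a_G(n)$ is the (finite) number of subgroups of index $n$. For a $G$-action $\alpha$ on a set $X$ and $L\in\mathcal{L}_G$, $\mathsf{F}_\alpha(L)$ is the cardinality of $\{x\in X: gx=x\text{ for all }g\in L\}$. When all $\mathsf{F}_\alpha(L)$ are finite, the dynamical zeta function of $\alpha$ is the formal power series $\zeta_\alpha(z)=\exp\sum_{L\in\mathcal{L}_G}\frac{\mathsf{F}_\alpha(L)}{[L]}z^{[L]}$. The zeta function of $G$ is the formal Dirichlet series $\zeta_G(z)=\sum_{n\geqslant 1}a_G(n)n^{-z}$ and, with $\zeta$ the Riemann zeta function, $\Delta_G$ is the formal Dirichlet series \[ \Delta_G(z)=\frac{\zeta_G(z+1)}{\zeta(z+1)}=\sum_{n\geqslant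 1}\frac{b_G(n)}{n^z}. \] For $b\in\mathbb{Q}$, $(1-A^nz^n)^{-b}$ is the formal power series $\exp(-b\log(1-A^nz^n))$. An alphabet is a nonempty set. The full shift $\sigma(G)$ of $G$ on $\mathcal{A}^G$ is the action given by $(hx)_g=x_{h^{-1}g}$ for $x=(x_g)_{g\in G}\in\mathcal{A}^G$ and $h\in G$. *)

theory Defs
  imports
    "HOL-Algebra.Group_Action"
    "HOL-Algebra.Generated_Groups"
    "HOL-Computational_Algebra.Formal_Power_Series"
    "HOL-Analysis.Infinite_Products"
begin

section \<open>Subgroups of finite index\<close>

definition finitely_generated :: "('g, 'm) monoid_scheme \<Rightarrow> bool" where
  "finitely_generated G \<longleftrightarrow> (\<exists>S. finite S \<and> S \<subseteq> carrier G \<and> generate G S = carrier G)"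

definition finite_index_subgroups :: "('g, 'm) monoid_scheme \<Rightarrow> 'g set set" where
  "finite_index_subgroups G = {L. subgroup L G \<and> finite (rcosets\<^bsub>G\<^esub> L)}"

definition subgroup_index :: "('g, 'm) monoid_scheme \<Rightarrow> 'g set \<Rightarrow> nat" where
  "subgroup_index G L = card (rcosets\<^bsub>G\<^esub> L)"

definition subgroups_of_index :: "('g, 'm) monoid_scheme \<Rightarrow> nat \<Rightarrow> 'g set set" where
  "subgroups_of_index G n = {L \<in> finite_index_subgroups G. subgroup_index G L = n}"

text \<open>In a finitely generated group there are only finitely many subgroups of each finite index,
  so the cardinalities and sums over \<^const>\<open>subgroups_of_index\<close> below are genuine.\<close>

lemma (in group) rcosets_shift:
  assumes "subgroup L G" "C \<in> rcosets L" "g \<in> carrier G"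
  shows "C #> g \<in> rcosets L"
proof -
  obtain a where a: "a \<in> carrier G" "C = L #> a"
    using assms(2) by (auto simp: RCOSETS_def)
  then have "C #> g = L #> (a \<otimes> g)"
    using assms by (simp add: coset_mult_assoc subgroup.subset)
  then show ?thesis
    using a assms by (simp add: rcosetsI subgroup.subset)
qed

lemma (in group) finite_subgroups_of_index:
  assumes "finitely_generated G"
  shows "finite (subgroups_of_index G n)"
proof -
  obtain S where S: "finite S" "S \<subseteq> carrier G" "generate G S = carrier G"
    using assms by (auto simp: finitely_generated_def)
  define I where "I = subgroups_of_index G n"
  have sub: "subgroup L G" if "L \<in> I" for L
    using that by (auto simp: I_def subgroups_of_index_def finite_index_subgroups_def)
  have "\<exists>e. bij_betw e (rcosets L) {0..<n}" if "L \<in> I" for L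
    using that ex_bij_betw_finite_nat[of "rcosets L"]
    by (auto simp: I_def subgroups_of_index_def finite_index_subgroups_def subgroup_index_def)
  then obtain e where e: "\<And>L. L \<in> I \<Longrightarrow> bij_betw (e L) (rcosets L) {0..<n}"
    by metis
  have inj: "C = D" if "L \<in> I" "C \<in> rcosets L" "D \<in> rcosets L" "e L C = e L D" for L C D
    using e[OF that(1)] that(2-4) by (auto simp: bij_betw_def inj_on_def)
  define T where "T L = (\<lambda>(s, i) \<in> S \<times> {0..<n}. e L (the_inv_into (rcosets L) (e L) i #> s))" for L
  have L_in: "L \<in> rcosets L" if "L \<in> I" for L
    using subgroup.subgroup_in_rcosets[OF sub[OF that] is_group] .
  have T: "T L (s, e L C) = e L (C #> s)" if "L \<in> I" "C \<in> rcosets L" "s \<in> S" for L C s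
  proof -
    have "e L C \<in> {0..<n}"
      using e[OF that(1)] that(2) by (auto simp: bij_betw_def)
    moreover have "the_inv_into (rcosets L) (e L) (e L C) = C"
      using e[OF that(1)] that(2) by (intro the_inv_into_f_f) (auto simp: bij_betw_def)
    ultimately show ?thesis
      using that(3) by (simp add: T_def)
  qed
  have assoc: "C #> g #> h = C #> (g \<otimes> h)" "C #> \<one> = C"
    if "L \<in> I" "C \<in> rcosets L" "g \<in> carrier G" "h \<in> carrier G" for L C g h
  proof -
    have "C \<subseteq> carrier G"
      using that(2) subgroup.rcosets_carrier[OF sub[OF that(1)] is_group] by blast
    then show "C #> g #> h = C #> (g \<otimes> h)" "C #> \<one> = C"
      using that by (auto simp: coset_mult_assoc)
  qed
  have main: "e L (C #> g) = e M (D #> g)"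
    if LM: "L \<in> I" "M \<in> I" and eq: "T L = T M" and g: "g \<in> generate G S"
      and CD: "C \<in> rcosets L" "D \<in> rcosets M" "e L C = e M D" for L M C D g
    using g CD
  proof (induction g arbitrary: C D rule: generate.induct)
    case one
    then show ?case
      using assoc(2)[OF LM(1) _ one_closed one_closed] assoc(2)[OF LM(2) _ one_closed one_closed]
      by simp
  next
    case (incl h)
    then show ?case using T LM eq by metis
  next
    case (inv h)
    have h: "h \<in> carrier G" "inv h \<in> carrier G" using inv S by auto
    have C1: "C #> inv h \<in> rcosets L" and D1: "D #> inv h \<in> rcosets M"
      using inv LM h by (auto intro: rcosets_shift sub)
    have "e L (C #> inv h) \<in> e M ` (rcosets M)"
      using C1 e[OF LM(1)] e[OF LM(2)] by (auto simp: bij_betw_def)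
    then obtain D' where D': "D' \<in> rcosets M" "e M D' = e L (C #> inv h)" by auto
    have "e M (D' #> h) = e L (C #> inv h #> h)"
      using T[OF LM(1) C1 inv(1)] T[OF LM(2) D'(1) inv(1)] D'(2) eq by simp
    also have "C #> inv h #> h = C"
      using assoc[OF LM(1) inv(2) h(2,1)] h by simp
    finally have "e M (D' #> h) = e M D" using inv by simp
    then have "D' #> h = D"
      using inj[OF LM(2)] inv D' h by (simp add: rcosets_shift sub LM)
    then have "D #> inv h = D'"
      using assoc[OF LM(2) D'(1) h] h by simp
    then show ?case using D' by simp
  next
    case (eng h1 h2)
    have h: "h1 \<in> carrier G" "h2 \<in> carrier G" using eng S by auto
    have "e L (C #> h1 #> h2) = e M (D #> h1 #> h2)"
      using eng h by (intro eng.IH) (auto intro: rcosets_shift sub LM)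
    then show ?case
      using assoc[OF LM(1) eng.prems(1) h] assoc[OF LM(2) eng.prems(2) h] by simp
  qed
  define U where "U L = (T L, e L L)" for L
  have le: "L \<subseteq> M" if LM: "L \<in> I" "M \<in> I" and eq: "U L = U M" for L M
  proof
    fix g assume g: "g \<in> L"
    then have gc: "g \<in> carrier G" using sub[OF LM(1)] subgroup.subset by blast
    have "e L (L #> g) = e M (M #> g)"
      using main[of L M g L M] LM eq gc S L_in by (auto simp: U_def)
    moreover have "L #> g = L"
      using g gc sub[OF LM(1)] by (simp add: subgroup.rcos_const is_group)
    ultimately have "e M (M #> g) = e M M" using eq by (simp add: U_def)
    then have "M #> g = M"
      using inj[OF LM(2)] L_in[OF LM(2)] gc by (simp add: rcosets_shift sub LM)
    then show "g \<in> M"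
      using gc rcos_self[OF gc sub[OF LM(2)]] by simp
  qed
  have "inj_on U I"
    using le by (intro inj_onI) (metis subset_antisym)
  moreover have "U ` I \<subseteq> (S \<times> {0..<n} \<rightarrow>\<^sub>E {0..<n}) \<times> {0..<n}"
  proof
    fix u assume "u \<in> U ` I"
    then obtain L where L: "L \<in> I" "u = U L" by auto
    have b: "e L C \<in> {0..<n}" if "C \<in> rcosets L" for C
      using e[OF L(1)] that by (auto simp: bij_betw_def)
    have "the_inv_into (rcosets L) (e L) i \<in> rcosets L" if "i \<in> {0..<n}" for i
      using e[OF L(1)] that by (intro the_inv_into_into) (auto simp: bij_betw_def)
    then have "T L (s, i) \<in> {0..<n}" if "s \<in> S" "i \<in> {0..<n}" for s i
      using that S unfolding T_def
      by (simp only: restrict_apply' mem_Sigma_iff simp_thms case_prod_conv)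
         (blast intro: b rcosets_shift sub L)
    moreover have "T L \<in> extensional (S \<times> {0..<n})" by (simp add: T_def)
    ultimately show "u \<in> (S \<times> {0..<n} \<rightarrow>\<^sub>E {0..<n}) \<times> {0..<n}"
      using L b[OF L_in[OF L(1)]] by (auto simp: U_def PiE_def)
  qed
  moreover have "finite ((S \<times> {0..<n} \<rightarrow>\<^sub>E {0..<n}) \<times> {0..<n})"
    using S by (intro finite_cartesian_product finite_PiE) auto
  ultimately show ?thesis
    unfolding I_def by (meson finite_imageD finite_subset)
qed


section \<open>The dynamical zeta function of a group action\<close>

text \<open>As in \<^locale>\<open>group_action\<close>, an action of \<open>G\<close> on \<open>X\<close> is a homomorphism \<open>\<phi>\<close> from \<open>G\<close> to
  \<^term>\<open>BijGroup X\<close>.\<close>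

definition fixed_points :: "'x set \<Rightarrow> ('g \<Rightarrow> 'x \<Rightarrow> 'x) \<Rightarrow> 'g set \<Rightarrow> 'x set" where
  "fixed_points X \<phi> L = {x \<in> X. \<forall>g\<in>L. \<phi> g x = x}"

text \<open>The exponent is the formal sum of \<open>F(L)/[L] z^[L]\<close> over all \<open>L\<close> of finite index; the terms
  contributing to the coefficient of \<open>z^n\<close> are those with \<open>[L] = n\<close>. There are none for \<open>n = 0\<close>,
  so the composition with the exponential series is the usual one.\<close>

definition dynamical_zeta ::
    "('g, 'm) monoid_scheme \<Rightarrow> 'x set \<Rightarrow> ('g \<Rightarrow> 'x \<Rightarrow> 'x) \<Rightarrow> rat fps" where
  "dynamical_zeta G X \<phi> = fps_exp 1 oo Abs_fps (\<lambda>n.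
     \<Sum>L\<in>subgroups_of_index G n.
       of_nat (card (fixed_points X \<phi> L)) / of_nat (subgroup_index G L))"

lemma (in group) subgroups_of_index_0: "subgroups_of_index G 0 = {}"
  using subgroup.subgroup_in_rcosets[OF _ is_group]
  by (fastforce simp: subgroups_of_index_def finite_index_subgroups_def subgroup_index_def)

definition full_shift ::
    "('g, 'm) monoid_scheme \<Rightarrow> 'a set \<Rightarrow> 'g \<Rightarrow> ('g \<Rightarrow> 'a) \<Rightarrow> ('g \<Rightarrow> 'a)" where
  "full_shift G A = (\<lambda>h. \<lambda>x \<in> carrier G \<rightarrow>\<^sub>E A. \<lambda>g \<in> carrier G. x (inv\<^bsub>G\<^esub> h \<otimes>\<^bsub>G\<^esub> g))"

definition trivial_action :: "'g \<Rightarrow> unit \<Rightarrow> unit" where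
  "trivial_action = (\<lambda>g. \<lambda>x \<in> {()}. x)"

lemma (in group) group_action_full_shift:
  "group_action G (carrier G \<rightarrow>\<^sub>E A) (full_shift G A)"
proof -
  let ?X = "carrier G \<rightarrow>\<^sub>E A" and ?s = "full_shift G A"
  have closed: "?s h x \<in> ?X" if "h \<in> carrier G" "x \<in> ?X" for h x
    using that by (auto simp: full_shift_def PiE_def Pi_def)
  have comp: "?s (h \<otimes> k) x = ?s h (?s k x)"
    if "h \<in> carrier G" "k \<in> carrier G" "x \<in> ?X" for h k x
  proof -
    have "?s h (?s k x) = (\<lambda>g\<in>carrier G. ?s k x (inv h \<otimes> g))"
      using closed[OF that(2,3)] by (simp add: full_shift_def)
    also have "\<dots> = (\<lambda>g\<in>carrier G. x (inv (h \<otimes> k) \<otimes> g))"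
      using that by (intro restrict_ext) (simp add: full_shift_def inv_mult_group m_assoc)
    finally show ?thesis using that by (simp add: full_shift_def)
  qed
  have one: "?s \<one> x = x" if "x \<in> ?X" for x
    using that by (auto simp: full_shift_def PiE_def extensional_def fun_eq_iff)
  have bij: "?s h \<in> Bij ?X" if "h \<in> carrier G" for h
  proof -
    have hi: "inv h \<in> carrier G" using that by simp
    have "?s h (?s (inv h) x) = x" "?s (inv h) (?s h x) = x" if "x \<in> ?X" for x
      using comp[OF \<open>h \<in> carrier G\<close> hi that] comp[OF hi \<open>h \<in> carrier G\<close> that] one[OF that]
        \<open>h \<in> carrier G\<close>
      by (metis r_inv l_inv)+
    then have "bij_betw (?s h) ?X ?X"
      using closed[OF that] closed[OF hi]
      by (intro bij_betw_byWitness[where f' = "?s (inv h)"] ballI image_subsetI)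
    moreover have "?s h \<in> extensional ?X"
      by (simp add: full_shift_def)
    ultimately show ?thesis by (simp add: Bij_def)
  qed
  have "?s \<in> hom G (BijGroup ?X)"
  proof (rule homI)
    fix h assume "h \<in> carrier G"
    then show "?s h \<in> carrier (BijGroup ?X)" using bij by (simp add: BijGroup_def)
  next
    fix h k assume hk: "h \<in> carrier G" "k \<in> carrier G"
    have "?s (h \<otimes> k) = compose ?X (?s h) (?s k)"
      using bij[of "h \<otimes> k"] hk comp
      by (intro extensionalityI[of _ ?X]) (auto simp: Bij_def compose_def)
    then show "?s (h \<otimes> k) = ?s h \<otimes>\<^bsub>BijGroup ?X\<^esub> ?s k"
      using bij hk by (simp add: BijGroup_def)
  qed
  then show ?thesis
    by (simp add: group_action_def group_hom_def group_hom_axioms_def group_BijGroup is_group)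
qed

lemma (in group) group_action_trivial_action: "group_action G {()} trivial_action"
proof -
  have bij: "(\<lambda>x\<in>{()}. x) \<in> Bij {()}" by (rule id_Bij)
  then have "trivial_action \<in> hom G (BijGroup {()})"
    by (intro homI) (auto simp: trivial_action_def BijGroup_def compose_def fun_eq_iff)
  then show ?thesis
    by (simp add: group_action_def group_hom_def group_hom_axioms_def group_BijGroup is_group)
qed

lemma (in group) finite_fixed_points_full_shift:
  assumes "finite A" "L \<in> finite_index_subgroups G"
  shows "finite (fixed_points (carrier G \<rightarrow>\<^sub>E A) (full_shift G A) L)"
proof -
  have L: "subgroup L G" "finite (rcosets L)"
    using assms by (auto simp: finite_index_subgroups_def)
  let ?lift = "\<lambda>f. \<lambda>g\<in>carrier G. f (L #> g)"
  have "fixed_points (carrier G \<rightarrow>\<^sub>E A) (full_shift G A) L \<subseteq> ?lift ` (rcosets L \<rightarrow>\<^sub>E A)"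
  proof
    fix x assume x: "x \<in> fixed_points (carrier G \<rightarrow>\<^sub>E A) (full_shift G A) L"
    then have xE: "x \<in> carrier G \<rightarrow>\<^sub>E A" by (simp add: fixed_points_def)
    have inv: "x (h \<otimes> g) = x g" if "h \<in> L" "g \<in> carrier G" for h g
    proof -
      have h: "h \<in> carrier G" using that(1) L(1) subgroup.subset by blast
      have "full_shift G A (inv h) x = x"
        using x subgroup.m_inv_closed[OF L(1) that(1)] by (simp add: fixed_points_def)
      then have "full_shift G A (inv h) x g = x g" by simp
      then show ?thesis using xE that(2) h by (simp add: full_shift_def)
    qed
    define f where "f = (\<lambda>C\<in>rcosets L. x (SOME c. c \<in> C))"
    have some: "x (SOME c. c \<in> L #> g) = x g" if g: "g \<in> carrier G" for g
    proof -
      have "(SOME c. c \<in> L #> g) \<in> L #> g"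
        using rcos_self[OF g L(1)] by (rule someI)
      then show ?thesis using inv g by (auto simp: r_coset_def)
    qed
    have "f \<in> rcosets L \<rightarrow>\<^sub>E A"
      using some xE by (auto simp: f_def RCOSETS_def)
    moreover have "x = ?lift f"
    proof (rule extensionalityI[of _ "carrier G"])
      show "x \<in> extensional (carrier G)" using xE by (simp add: PiE_def)
      fix g assume "g \<in> carrier G"
      then show "x g = ?lift f g"
        using some L(1) by (simp add: f_def rcosetsI subgroup.subset)
    qed auto
    ultimately show "x \<in> ?lift ` (rcosets L \<rightarrow>\<^sub>E A)" by blast
  qed
  moreover have "finite (rcosets L \<rightarrow>\<^sub>E A)"
    using L assms by (intro finite_PiE) auto
  ultimately show ?thesis by (meson finite_imageI finite_subset)
qed


section \<open>Formal Dirichlet series\<close>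

text \<open>The formal Dirichlet series \<open>\<Sum>n\<ge>1. f n / n^z\<close> is represented by its coefficient function \<open>f\<close>;
  the value \<open>f 0\<close> carries no information.\<close>

definition ds_mult :: "(nat \<Rightarrow> 'a::field) \<Rightarrow> (nat \<Rightarrow> 'a) \<Rightarrow> nat \<Rightarrow> 'a" where
  "ds_mult f g n = (\<Sum>d | d dvd n. f d * g (n div d))"

text \<open>Division of formal Dirichlet series by a series with \<open>g 1 \<noteq> 0\<close>, solved recursively for the
  coefficients of the quotient; the next two lemmas show that it is the unique quotient.\<close>

function ds_divide :: "(nat \<Rightarrow> 'a::field) \<Rightarrow> (nat \<Rightarrow> 'a) \<Rightarrow> nat \<Rightarrow> 'a" where
  "ds_divide f g n = (if n = 0 then 0
     else (f n - (\<Sum>d | d dvd n \<and> d < n. ds_divide f g d * g (n div d))) / g 1)"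
  by pat_completeness auto
termination
  by (relation "measure (\<lambda>(f, g, n). n)") auto

declare ds_divide.simps [simp del]

lemma ds_mult_split:
  assumes "n > 0"
  shows "ds_mult h g n = h n * g 1 + (\<Sum>d | d dvd n \<and> d < n. h d * g (n div d))"
proof -
  have "{d. d dvd n} = insert n {d. d dvd n \<and> d < n}"
    using assms by (auto dest: dvd_imp_le)
  then show ?thesis using assms by (simp add: ds_mult_def)
qed

lemma ds_mult_divide:
  assumes "g 1 \<noteq> 0" "n > 0"
  shows "ds_mult (ds_divide f g) g n = f n"
  using assms ds_divide.simps[of f g n] by (simp add: ds_mult_split)

lemma ds_divide_unique:
  assumes "g 1 \<noteq> 0" "\<And>n. n > 0 \<Longrightarrow> ds_mult h g n = f n" "n > 0"
  shows "h n = ds_divide f g n"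
  using \<open>n > 0\<close>
proof (induction n rule: less_induct)
  case (less n)
  have "(\<Sum>d | d dvd n \<and> d < n. h d * g (n div d)) =
        (\<Sum>d | d dvd n \<and> d < n. ds_divide f g d * g (n div d))"
    using less by (intro sum.cong) (auto intro!: Nat.gr0I)
  moreover have "ds_mult h g n = ds_mult (ds_divide f g) g n"
    using assms less.prems by (simp add: ds_mult_divide)
  ultimately have "h n * g 1 = ds_divide f g n * g 1"
    unfolding ds_mult_split[OF less.prems] by simp
  then show ?case using assms(1) by simp
qed

text \<open>Substituting \<open>z + 1\<close> for \<open>z\<close> divides the \<open>n\<close>-th coefficient by \<open>n\<close>.\<close>

definition ds_shift1 :: "(nat \<Rightarrow> 'a::field) \<Rightarrow> nat \<Rightarrow> 'a" where
  "ds_shift1 f n = f n / of_nat n"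

definition ds_riemann_zeta :: "nat \<Rightarrow> rat" where
  "ds_riemann_zeta n = 1"

definition ds_group_zeta :: "('g, 'm) monoid_scheme \<Rightarrow> nat \<Rightarrow> rat" where
  "ds_group_zeta G n = of_nat (card (subgroups_of_index G n))"

definition ds_Delta :: "('g, 'm) monoid_scheme \<Rightarrow> nat \<Rightarrow> rat" where
  "ds_Delta G = ds_divide (ds_shift1 (ds_group_zeta G)) (ds_shift1 ds_riemann_zeta)"


section \<open>Rational powers of formal power series\<close>

text \<open>\<open>f^b = exp (b log f)\<close> for \<open>f\<close> with constant term 1; here \<^term>\<open>fps_ln 1\<close> is the series of
  \<open>log (1 + z)\<close>.\<close>

definition fps_rat_power :: "rat fps \<Rightarrow> rat \<Rightarrow> rat fps" where
  "fps_rat_power f b = fps_exp 1 oo (fps_const b * (fps_ln 1 oo (f - 1)))"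

end

theory Submission
  imports Defs
begin

text \<open>A point of the full shift is fixed by \<open>L\<close> iff it is constant on the right cosets of \<open>L\<close>, so
  there are \<open>A^[L]\<close> such points. The exponent of the zeta function of the full shift is therefore
  that of the trivial action evaluated at \<open>A z\<close>, namely \<open>\<Sum>n. a n / n * (A z)^n\<close>. The identity
  \<open>a N / N = \<Sum>d dvd N. b d * (d / N)\<close> defining \<open>\<Delta>\<close> rewrites this exponent as
  \<open>\<Sum>n. - b n * log (1 - A^n z^n)\<close>, and exponentiation turns the sum into the product.\<close>

section \<open>Fixed points of the full shift\<close>

text \<open>Pulling functions on cosets back along \<open>g\<close> |-> \<open>L #> g\<close> is a
  bijection onto the fixed points. It is injective because every right coset has the form
  \<open>L #> g\<close>.\<close>

lemma (in group) card_fixed_points_full_shift: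
  assumes L: "subgroup L G" and fin: "finite (rcosets L)"
  shows "card (fixed_points (carrier G \<rightarrow>\<^sub>E A) (full_shift G A) L) = card A ^ card (rcosets L)"
proof -
  let ?lift = "\<lambda>f. \<lambda>g\<in>carrier G. f (L #> g)"
  let ?F = "fixed_points (carrier G \<rightarrow>\<^sub>E A) (full_shift G A) L"
  have Lc: "h \<in> carrier G" if "h \<in> L" for h
    using that L subgroup.subset by blast
  have coset: "L #> (h \<otimes> g) = L #> g" if "h \<in> L" "g \<in> carrier G" for h g
    using that L Lc
    by (metis coset_mult_assoc subgroup.subset subgroup.rcos_const is_group)
  have "?lift ` (rcosets L \<rightarrow>\<^sub>E A) = ?F"
  proof (intro equalityI subsetI)
    fix x assume "x \<in> ?lift ` (rcosets L \<rightarrow>\<^sub>E A)"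
    then obtain f where f: "f \<in> rcosets L \<rightarrow>\<^sub>E A" "x = ?lift f" by auto
    have xE: "x \<in> carrier G \<rightarrow>\<^sub>E A"
      using f L by (auto simp: rcosetsI subgroup.subset)
    moreover have "full_shift G A h x = x" if "h \<in> L" for h
    proof (rule extensionalityI[of _ "carrier G"])
      show "full_shift G A h x \<in> extensional (carrier G)" "x \<in> extensional (carrier G)"
        using xE by (auto simp: full_shift_def PiE_def)
      fix g assume g: "g \<in> carrier G"
      then show "full_shift G A h x g = x g"
        using xE Lc[OF that] coset[OF subgroup.m_inv_closed[OF L that] g]
        by (simp add: full_shift_def f(2))
    qed
    ultimately show "x \<in> ?F" by (simp add: fixed_points_def)
  next
    fix x assume x: "x \<in> ?F"
    then have xE: "x \<in> carrier G \<rightarrow>\<^sub>E A" by (simp add: fixed_points_def)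
    have inv: "x (h \<otimes> g) = x g" if "h \<in> L" "g \<in> carrier G" for h g
    proof -
      have "full_shift G A (inv h) x = x"
        using x subgroup.m_inv_closed[OF L that(1)] by (simp add: fixed_points_def)
      then have "full_shift G A (inv h) x g = x g" by simp
      then show ?thesis using xE that(2) Lc[OF that(1)] by (simp add: full_shift_def)
    qed
    \<comment> \<open>The preimage of \<open>x\<close> reads off the value at an arbitrary
      representative; by \<open>inv\<close> the choice does not matter.\<close>
    define f where "f = (\<lambda>C\<in>rcosets L. x (SOME c. c \<in> C))"
    have some: "x (SOME c. c \<in> L #> g) = x g" if g: "g \<in> carrier G" for g
    proof -
      have "(SOME c. c \<in> L #> g) \<in> L #> g"
        using rcos_self[OF g L] by (rule someI)
      then show ?thesis using inv g by (auto simp: r_coset_def)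
    qed
    have "f \<in> rcosets L \<rightarrow>\<^sub>E A"
      using some xE by (auto simp: f_def RCOSETS_def)
    moreover have "x = ?lift f"
    proof (rule extensionalityI[of _ "carrier G"])
      show "x \<in> extensional (carrier G)" using xE by (simp add: PiE_def)
      fix g assume "g \<in> carrier G"
      then show "x g = ?lift f g"
        using some L by (simp add: f_def rcosetsI subgroup.subset)
    qed auto
    ultimately show "x \<in> ?lift ` (rcosets L \<rightarrow>\<^sub>E A)" by blast
  qed
  moreover have "inj_on ?lift (rcosets L \<rightarrow>\<^sub>E A)"
  proof (rule inj_onI)
    fix f f' assume f: "f \<in> rcosets L \<rightarrow>\<^sub>E A" "f' \<in> rcosets L \<rightarrow>\<^sub>E A" and eq: "?lift f = ?lift f'"
    show "f = f'"
    proof (rule PiE_ext[OF f])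
      fix C assume "C \<in> rcosets L"
      then obtain g where "g \<in> carrier G" "C = L #> g" by (auto simp: RCOSETS_def)
      then show "f C = f' C" using fun_cong[OF eq, of g] by simp
    qed
  qed
  ultimately show ?thesis
    using card_image[of ?lift "rcosets L \<rightarrow>\<^sub>E A"] fin by (simp add: card_PiE)
qed

section \<open>Exponentials of formal power series\<close>

text \<open>The coefficient of degree m in the equation expresses (m+1) d_(m+1) through d_0, ...,
  d_m, and m+1 is invertible in characteristic 0.\<close>

lemma fps_linear_ODE_zero:
  fixes d w :: "'a::field_char_0 fps"
  assumes "fps_deriv d = d * w" "fps_nth d 0 = 0"
  shows "d = 0"
proof -
  have "fps_nth d n = 0" for n
  proof (induction n rule: less_induct)
    case (less n)
    show ?case
    proof (cases n)
      case (Suc m)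
      have "of_nat (Suc m) * fps_nth d (Suc m) = fps_nth (d * w) m"
        using arg_cong[OF assms(1), of "\<lambda>f. fps_nth f m"] by simp
      also have "\<dots> = 0"
        using less Suc by (simp add: fps_mult_nth)
      finally show ?thesis using Suc by (simp del: of_nat_Suc)
    qed (use assms in simp)
  qed
  then show ?thesis by (simp add: fps_eq_iff)
qed

text \<open>Both sides solve y' = y u' with constant term 1, so their difference solves the same
  linear equation with constant term 0. The functional equations of exp below reduce to checking
  this equation.\<close>

lemma fps_exp_compose_unique:
  fixes y u :: "'a::field_char_0 fps"
  assumes "fps_deriv y = y * fps_deriv u" "fps_nth y 0 = 1" "fps_nth u 0 = 0"
  shows "y = fps_exp 1 oo u"
proof -
  have "y - (fps_exp 1 oo u) = 0"
    by (rule fps_linear_ODE_zero[of _ "fps_deriv u"])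
       (use assms in \<open>simp_all add: fps_compose_deriv algebra_simps\<close>)
  then show ?thesis by simp
qed

lemma fps_exp_compose_add:
  fixes u v :: "'a::field_char_0 fps"
  assumes "fps_nth u 0 = 0" "fps_nth v 0 = 0"
  shows "fps_exp 1 oo (u + v) = (fps_exp 1 oo u) * (fps_exp 1 oo v)"
  by (rule fps_exp_compose_unique[symmetric])
     (use assms in \<open>simp_all add: fps_compose_deriv algebra_simps\<close>)

lemma fps_exp_compose_sum:
  fixes u :: "'b \<Rightarrow> 'a::field_char_0 fps"
  assumes "\<And>i. i \<in> I \<Longrightarrow> fps_nth (u i) 0 = 0"
  shows "fps_exp 1 oo (\<Sum>i\<in>I. u i) = (\<Prod>i\<in>I. fps_exp 1 oo u i)"
  using assms
  by (induction I rule: infinite_finite_induct)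
     (simp_all add: fps_exp_compose_add fps_sum_nth)

text \<open>The derivative of log(1 + u) is u'/(1 + u), so 1 + u solves the equation that
  characterises the exponential.\<close>

lemma fps_exp_compose_ln:
  fixes u :: "'a::field_char_0 fps"
  assumes "fps_nth u 0 = 0"
  shows "fps_exp 1 oo (fps_ln 1 oo u) = 1 + u"
proof (rule fps_exp_compose_unique[symmetric])
  have "fps_deriv (fps_ln 1 oo u) = inverse (1 + u) * fps_deriv u"
    using assms
    by (simp add: fps_compose_deriv fps_ln_deriv fps_inverse_compose fps_compose_add_distrib)
  then show "fps_deriv (1 + u) = (1 + u) * fps_deriv (fps_ln 1 oo u)"
    using inverse_mult_eq_1[of "1 + u"] assms by (simp add: algebra_simps)
qed (use assms in auto)

lemma fps_power_nth_cong:
  fixes u v :: "'a::comm_semiring_1 fps"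
  assumes "\<And>k. k \<le> n \<Longrightarrow> fps_nth u k = fps_nth v k"
  shows "fps_nth (u ^ i) n = fps_nth (v ^ i) n"
  using assms
  by (induction i arbitrary: n) (simp_all add: fps_mult_nth)

text \<open>Coefficient n of each power of u involves only coefficients of u up to n. This allows an
  infinite exponent to be replaced by a partial sum.\<close>

lemma fps_compose_nth_cong:
  fixes u v :: "'a::comm_semiring_1 fps"
  assumes "\<And>k. k \<le> n \<Longrightarrow> fps_nth u k = fps_nth v k"
  shows "fps_nth (f oo u) n = fps_nth (f oo v) n"
  using fps_power_nth_cong[OF assms] by (simp add: fps_compose_nth)

text \<open>The i-th power of c X^n is c^i X^(n i), so only i = N/n can contribute to degree
  N.\<close>

lemma fps_compose_monom_nth:
  fixes f :: "'a::comm_ring_1 fps"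
  assumes "n > 0"
  shows "fps_nth (f oo (fps_const c * fps_X ^ n)) N =
    (if n dvd N then fps_nth f (N div n) * c ^ (N div n) else 0)"
proof -
  have "fps_nth (f oo (fps_const c * fps_X ^ n)) N =
      (\<Sum>i=0..N. if N = n * i then fps_nth f i * c ^ i else 0)"
    unfolding fps_compose_nth
    by (intro sum.cong)
       (auto simp: power_mult_distrib fps_const_power simp flip: power_mult)
  also have "\<dots> = (\<Sum>i=0..N. if i = N div n then if n dvd N then fps_nth f i * c ^ i else 0 else 0)"
    using assms by (intro sum.cong) auto
  also have "\<dots> = (if n dvd N then fps_nth f (N div n) * c ^ (N div n) else 0)"
    by (subst sum.delta) auto
  finally show ?thesis .
qed

section \<open>Formal power series with integer coefficients\<close>

definition fps_integral :: "'a::ring_1 fps \<Rightarrow> bool" where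
  "fps_integral f \<longleftrightarrow> (\<forall>n. fps_nth f n \<in> \<int>)"

lemma fps_integral_1: "fps_integral 1"
  by (simp add: fps_integral_def)

lemma fps_integral_mult:
  "fps_integral f \<Longrightarrow> fps_integral g \<Longrightarrow> fps_integral (f * g)"
  by (auto simp: fps_integral_def fps_mult_nth)

lemma fps_integral_power:
  "fps_integral f \<Longrightarrow> fps_integral (f ^ n)"
  by (induction n) (simp_all add: fps_integral_1 fps_integral_mult)

lemma fps_integral_prod:
  fixes f :: "'b \<Rightarrow> 'a::comm_ring_1 fps"
  shows "(\<And>i. i \<in> I \<Longrightarrow> fps_integral (f i)) \<Longrightarrow> fps_integral (\<Prod>i\<in>I. f i)"
  by (induction I rule: infinite_finite_induct) (simp_all add: fps_integral_1 fps_integral_mult)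

text \<open>With constant term 1, the recurrence obtained from f * inverse f = 1 involves no
  division.\<close>

lemma fps_integral_inverse:
  fixes f :: "'a::field fps"
  assumes f: "fps_integral f" and "fps_nth f 0 = 1"
  shows "fps_integral (inverse f)"
proof -
  have "fps_nth (inverse f) n \<in> \<int>" for n
  proof (induction n rule: less_induct)
    case (less n)
    show ?case
    proof (cases "n = 0")
      case False
      have "0 = fps_nth (f * inverse f) n"
        using assms False inverse_mult_eq_1'[of f] by simp
      also have "\<dots> = fps_nth (inverse f) n + (\<Sum>i=1..n. fps_nth f i * fps_nth (inverse f) (n - i))"
        using assms by (simp add: fps_mult_nth sum.atLeast_Suc_atMost)
      finally have "fps_nth (inverse f) n = - (\<Sum>i=1..n. fps_nth f i * fps_nth (inverse f) (n - i))"
        by (simp add: eq_neg_iff_add_eq_0)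
      moreover have "(\<Sum>i=1..n. fps_nth f i * fps_nth (inverse f) (n - i)) \<in> \<int>"
        using f less False by (intro Ints_sum Ints_mult) (auto simp: fps_integral_def)
      ultimately show ?thesis by simp
    qed (use assms in simp)
  qed
  then show ?thesis by (simp add: fps_integral_def)
qed

text \<open>Writing k log f as a sum of k equal terms turns its exponential into a product of k
  copies of f.\<close>

lemma fps_rat_power_of_nat:
  assumes "fps_nth f 0 = 1"
  shows "fps_rat_power f (of_nat k) = f ^ k"
proof -
  have *: "fps_const (of_nat k) * (fps_ln 1 oo (f - 1)) = (\<Sum>i<k. fps_ln 1 oo (f - 1))"
    by (simp add: fps_of_nat)
  show ?thesis
    unfolding fps_rat_power_def * using assms
    by (subst fps_exp_compose_sum) (simp_all add: fps_exp_compose_ln)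
qed

lemma fps_rat_power_minus:
  assumes "fps_nth f 0 = 1"
  shows "fps_rat_power f (- b) = inverse (fps_rat_power f b)"
proof -
  have "fps_rat_power f (- b) * fps_rat_power f b = 1"
    unfolding fps_rat_power_def
    by (subst fps_exp_compose_add[symmetric]) (simp_all flip: distrib_right)
  then show ?thesis by (metis fps_inverse_unique mult.commute)
qed

lemma fps_integral_rat_power:
  assumes "fps_integral f" "fps_nth f 0 = 1" "b \<in> \<int>"
  shows "fps_integral (fps_rat_power f b)"
proof -
  obtain z where z: "b = of_int z" using assms(3) by (auto elim: Ints_cases)
  show ?thesis
  proof (cases "z \<ge> 0")
    case True
    then have "b = of_nat (nat z)" using z by simp
    then show ?thesis using assms by (simp add: fps_rat_power_of_nat fps_integral_power)
  next
    case False
    then have "b = - of_nat (nat (- z))" using z by simp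
    then show ?thesis
      using assms
      by (simp add: fps_rat_power_minus fps_rat_power_of_nat fps_integral_power
          fps_integral_inverse fps_power_zeroth)
  qed
qed

section \<open>The product formula\<close>

text \<open>This compares the coefficients at N in \<Delta>(z) \<zeta>(z+1) = \<zeta>_G(z+1); the
  factor 1/(N/d) comes from \<zeta>(z+1).\<close>

lemma ds_Delta_sum:
  assumes "N > 0"
  shows "(\<Sum>d | d dvd N. ds_Delta G d / of_nat (N div d)) =
    of_nat (card (subgroups_of_index G N)) / of_nat N"
  using ds_mult_divide[of "ds_shift1 ds_riemann_zeta" N "ds_shift1 (ds_group_zeta G)"] assms
  by (simp add: ds_Delta_def ds_mult_def ds_shift1_def ds_riemann_zeta_def ds_group_zeta_def)

text \<open>Convergence of formal power series means that each coefficient is eventually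
  constant.\<close>

lemma fps_prod_tendstoI:
  fixes f :: "nat \<Rightarrow> 'a::comm_ring_1 fps"
  assumes "\<And>N n. n \<ge> N \<Longrightarrow> fps_nth (\<Prod>k\<le>n. f k) N = fps_nth P N"
  shows "(\<lambda>n. \<Prod>k\<le>n. f k) \<longlonglongrightarrow> P"
  using assms by (intro tendsto_fpsI) (auto simp: eventually_sequentially)

theorem theorem4p1:
  fixes G :: "('g, 'm) monoid_scheme" and \<A> :: "'a set" and A :: nat
  assumes "group G" and "infinite (carrier G)" and "finitely_generated G"
    and "finite \<A>" and "\<A> \<noteq> {}" and "A = card \<A>"
  shows
    "dynamical_zeta G (carrier G \<rightarrow>\<^sub>E \<A>) (full_shift G \<A>) =
       dynamical_zeta G {()} trivial_action oo (fps_const (of_nat A) * fps_X) \<and>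
     (\<lambda>k. let n = Suc k in
        fps_rat_power (1 - fps_const (of_nat A ^ n) * fps_X ^ n) (- ds_Delta G n)) has_prod
       dynamical_zeta G (carrier G \<rightarrow>\<^sub>E \<A>) (full_shift G \<A>) \<and>
     ((\<forall>n\<ge>1. ds_Delta G n \<in> \<int>) \<longrightarrow>
       (\<forall>n. fps_nth (dynamical_zeta G (carrier G \<rightarrow>\<^sub>E \<A>) (full_shift G \<A>)) n \<in> \<int>))"
proof -
  interpret group G by fact
  let ?Z = "dynamical_zeta G (carrier G \<rightarrow>\<^sub>E \<A>) (full_shift G \<A>)"
  define a :: "nat \<Rightarrow> rat" where "a n = of_nat (card (subgroups_of_index G n))" for n
  \<comment> \<open>\<open>E\<close> is the exponent of \<open>?Z\<close>. Its constant term is 0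
    since division by 0 gives 0.\<close>
  define E where "E = Abs_fps (\<lambda>n. of_nat A ^ n * (a n / of_nat n))"
  have a0: "a 0 = 0" by (simp add: a_def subgroups_of_index_0)
  have E0: "fps_nth E 0 = 0" by (simp add: E_def)
  have summand: "of_nat (card (fixed_points (carrier G \<rightarrow>\<^sub>E \<A>) (full_shift G \<A>) L)) /
      of_nat (subgroup_index G L) = (of_nat A ^ n / of_nat n :: rat)"
    if "L \<in> subgroups_of_index G n" for L n
    using that card_fixed_points_full_shift[of L \<A>] assms
    by (auto simp: subgroups_of_index_def finite_index_subgroups_def subgroup_index_def)
  have Z: "?Z = fps_exp 1 oo E"
    unfolding dynamical_zeta_def E_def a_def
    by (intro arg_cong2[where f = fps_compose] refl arg_cong[where f = Abs_fps] ext)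
       (simp add: summand)
  have "fixed_points {()} trivial_action L = {()}" for L :: "'g set"
    by (auto simp: fixed_points_def)
  moreover have "subgroup_index G L = n" if "L \<in> subgroups_of_index G n" for L n
    using that by (simp add: subgroups_of_index_def)
  ultimately have T: "dynamical_zeta G {()} trivial_action = fps_exp 1 oo Abs_fps (\<lambda>n. a n / of_nat n)"
    unfolding dynamical_zeta_def a_def
    by (intro arg_cong2[where f = fps_compose] refl arg_cong[where f = Abs_fps] ext) simp
  have first: "?Z = dynamical_zeta G {()} trivial_action oo (fps_const (of_nat A) * fps_X)"
    unfolding Z T
    \<comment> \<open>By associativity the substitution acts on the exponent, where it scales
      coefficient n by A^n.\<close>
    by (subst fps_compose_assoc[symmetric]) (simp_all add: E_def fps_compose_linear a0)

  \<comment> \<open>\<open>u n\<close> is -b_n log(1 - A^n X^n). The factors \<open>f k\<close> are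
    indexed from 0, so \<open>f k\<close> has exponent \<open>u (Suc k)\<close>.\<close>
  define u where "u n = fps_const (- ds_Delta G n) *
    (fps_ln 1 oo (fps_const (- (of_nat A ^ n)) * fps_X ^ n))" for n
  define f where "f k = fps_rat_power (1 - fps_const (of_nat A ^ Suc k) * fps_X ^ Suc k)
    (- ds_Delta G (Suc k))" for k
  have u0: "fps_nth (u n) 0 = 0" for n by (simp add: u_def)
  have f: "f k = fps_exp 1 oo u (Suc k)" for k
  proof -
    have "1 - fps_const (of_nat A ^ Suc k) * fps_X ^ Suc k - 1 =
        fps_const (- (of_nat A ^ Suc k) :: rat) * fps_X ^ Suc k"
      by (simp flip: fps_const_neg)
    then show ?thesis by (simp only: f_def u_def fps_rat_power_def)
  qed
  \<comment> \<open>With m = N/n, this is the expansion -log(1 - A^n X^n) = sum of A^(n m) X^(n m) /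
    m over m > 0, scaled by b_n.\<close>
  have u: "fps_nth (u n) N = (if n dvd N \<and> N > 0 then
      ds_Delta G n * of_nat A ^ N / of_nat (N div n) else 0)" if "n > 0" for n N
  proof (cases "n dvd N \<and> N > 0")
    case True
    then have m: "N div n > 0" and N: "n * (N div n) = N"
      using that by (auto simp: dvd_imp_le div_greater_zero_iff)
    have "(-1::rat) ^ (N div n - 1) * (- (of_nat A ^ n)) ^ (N div n) = - (of_nat A ^ N)"
    proof -
      have "(-1::rat) ^ (N div n - 1) * (- (of_nat A ^ n)) ^ (N div n) =
          ((-1) ^ (N div n - 1) * (-1) ^ (N div n)) * (of_nat A ^ n) ^ (N div n)"
        by (subst power_minus) simp
      also have "(-1::rat) ^ (N div n - 1) * (-1) ^ (N div n) = -1"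
        using m by (cases "N div n") (simp_all flip: power_mult_distrib)
      finally show ?thesis using N by (simp flip: power_mult)
    qed
    then show ?thesis
      using True m that
      by (simp add: u_def fps_compose_monom_nth fps_ln_nth)
  next
    case False
    then show ?thesis
      using that by (auto simp: u_def fps_compose_monom_nth)
  qed
  have sum_u: "fps_nth (\<Sum>k\<le>n. u (Suc k)) N = fps_nth E N" if "N \<le> n" for n N
  proof (cases "N = 0")
    case False
    have "fps_nth (\<Sum>k\<le>n. u (Suc k)) N = (\<Sum>d\<in>Suc ` {..n}. fps_nth (u d) N)"
      by (simp add: fps_sum_nth sum.reindex)
    \<comment> \<open>Indices that do not divide N contribute 0, and since 0 < N \<le> n every
      divisor of N lies in {1..n+1}.\<close>
    also have "\<dots> = (\<Sum>d | d dvd N. of_nat A ^ N * (ds_Delta G d / of_nat (N div d)))"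
    proof (rule sum.mono_neutral_cong_right)
      show "{d. d dvd N} \<subseteq> Suc ` {..n}"
        unfolding image_Suc_atMost using that False dvd_pos_nat[of N]
        by (force simp: Suc_le_eq dest: dvd_imp_le)
    qed (use False in \<open>auto simp: u split: if_splits\<close>)
    also have "\<dots> = fps_nth E N"
      using ds_Delta_sum[of N G] False
      by (simp add: E_def a_def sum_distrib_left[symmetric] del: times_divide_eq_right)
    finally show ?thesis .
  qed (simp add: fps_sum_nth u0 E0)
  \<comment> \<open>The exponents of \<open>?Z\<close> and of the partial product agree up to degree
    N, hence so do the exponentials.\<close>
  have prod_nth: "fps_nth (\<Prod>k\<le>n. f k) N = fps_nth ?Z N" if "N \<le> n" for n N
  proof -
    have "(\<Prod>k\<le>n. f k) = fps_exp 1 oo (\<Sum>k\<le>n. u (Suc k))"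
      by (simp add: f fps_exp_compose_sum u0)
    then show ?thesis
      unfolding Z using sum_u that by (auto intro!: fps_compose_nth_cong)
  qed
  \<comment> \<open>\<open>raw_has_prod\<close> demands a nonzero limit; the constant term of
    \<open>?Z\<close> is 1.\<close>
  have "?Z \<noteq> 0"
    using Z by (auto simp: fps_eq_iff intro!: exI[of _ 0])
  then have second: "f has_prod ?Z"
    using fps_prod_tendstoI[of f ?Z] prod_nth by (simp add: has_prod_def raw_has_prod_def)
  have third: "fps_nth ?Z N \<in> \<int>" if b: "\<forall>n\<ge>1. ds_Delta G n \<in> \<int>" for N
  proof -
    have "fps_integral (1 - fps_const (of_nat A ^ Suc k) * fps_X ^ Suc k :: rat fps)" for k
      by (auto simp: fps_integral_def simp del: power_Suc)
    then have "fps_integral (f k)" for k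
      unfolding f_def using b by (intro fps_integral_rat_power) auto
    \<comment> \<open>Coefficient N of \<open>?Z\<close> is already that of this finite product, so
      no limit of integral series is needed.\<close>
    then have "fps_integral (\<Prod>k\<le>N. f k)"
      by (intro fps_integral_prod)
    then show ?thesis by (simp add: fps_integral_def flip: prod_nth[of N N])
  qed
  from first second third show ?thesis
    by (auto simp: f_def[abs_def] Let_def)
qed

end
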